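(* Let $\mathcal{H}$ be a finite-dimensional complex Hilbert space. Then the norm closure of $\mathfrak{c}(\mathrm{nil}_2) := \{MN - NM : M, N \in \mathcal{B}(\mathcal{H}),\ M^2 = 0 = N^2\}$ equals $\mathrm{Bal}(\mathcal{H})$, the set of balanced operators on $\mathcal{H}$.
   Context: An operator $T \in \mathcal{B}(\mathcal{H})$ is balanced if: (a) $\sigma(T) = \sigma(-T)$; (b) whenever $\Omega_1, \Omega_2 \subseteq \mathbb{C}$ are disjoint open sets with $\sigma(T) \subseteq \Omega_1 \cup \Omega_2$, one has $\dim \mathcal{H}(\Omega_1; T) = \dim \mathcal{H}(-\Omega_1; T)$, where $\mathcal{H}(\Omega; T)$ denotes the range of the Riesz idempotent of $T$ corresponding to the clopen part $\sigma(T) \cap \Omega$ of the spectrum; (c) for every $\alpha \in \mathbb{C}$, $T - \alpha I$ is semi-Fredholm iff $T + \alpha I$ is semi-Fredholm, in which case $\mathrm{ind}(T - \alpha I) = \mathrm{ind}(T + \alpha I)$ (here the semi-Fredholm index is $\dim\ker(T-\alpha I) - \dim\ker(T-\alpha I)^*$). (In finite dimensions this amounts to: $\alpha \in \sigma(T)$ implies $-\alpha \in \sigma(T)$ with equal algebraic multiplicities.) *)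

theory Defs
  imports "HOL-Analysis.Analysis" "HOL-Computational_Algebra.Polynomial"
begin

text \<open>Operators on a finite-dimensional complex Hilbert space of dimension CARD('n),
  represented as complex matrices w.r.t. an orthonormal basis.\<close>

definition charpoly :: "complex^'n^'n \<Rightarrow> complex poly" where
  "charpoly A = det (\<chi> i j. (if i = j then [:0, 1:] else 0) - [:A $ i $ j:])"

definition alg_mult :: "complex^'n^'n \<Rightarrow> complex \<Rightarrow> nat" where
  "alg_mult A \<alpha> = order \<alpha> (charpoly A)"

definition balanced :: "complex^'n^'n \<Rightarrow> bool" where
  "balanced A \<longleftrightarrow> (\<forall>\<alpha>. alg_mult A \<alpha> = alg_mult A (-\<alpha>))"

end

theory Submission
  imports Defs "HOL-Computational_Algebra.Fundamental_Theorem_Algebra"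
begin

text \<open>
  If \<open>T = MN - NM\<close> with \<open>M\<^sup>2 = N\<^sup>2 = 0\<close>, then \<open>T = (M - N)(M + N)\<close> and \<open>-T = (M + N)(M - N)\<close>,
  so \<open>T\<close> and \<open>-T\<close> have the same characteristic polynomial; this is a closed condition on \<open>T\<close>
  and says that \<open>T\<close> is balanced.
  Conversely, triangularize a balanced \<open>T\<close> and match its diagonal entries into opposite pairs,
  leaving out at most one entry, which is \<open>0\<close>. An arbitrarily small perturbation of the diagonal
  keeps the pairs opposite and makes all entries distinct. The perturbed matrix is similar to a
  direct sum of blocks \<open>diag (a, -a)\<close> and possibly a zero, and
  \<open>diag (a, -a) = [a E\<^sub>1\<^sub>2, E\<^sub>2\<^sub>1]\<close>.
\<close>

section \<open>Triangularization\<close>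

text \<open>This is \<open>p(A) v\<close>, written through the iterates \<open>A^i v\<close> so that
  no matrix powers are formed.\<close>

definition poly_act :: "complex^'n^'n \<Rightarrow> complex poly \<Rightarrow> complex^'n \<Rightarrow> complex^'n" where
  "poly_act A p v = (\<Sum>i\<le>degree p. coeff p i *s (((*v) A) ^^ i) v)"

lemma poly_act_altdef:
  assumes "degree p \<le> N"
  shows "poly_act A p v = (\<Sum>i\<le>N. coeff p i *s (((*v) A) ^^ i) v)"
  unfolding poly_act_def
  by (rule sum.mono_neutral_left) (use assms in \<open>auto simp: coeff_eq_0\<close>)

lemma funpow_matrix_vector_diff_scale:
  fixes A :: "complex^'n^'n"
  shows "(((*v) A) ^^ i) (x - a *s y) = (((*v) A) ^^ i) x - a *s (((*v) A) ^^ i) y"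
  by (induction i) (auto simp: matrix_vector_mult_diff_distrib vector_scalar_commute)

text \<open>Since \<open>((X - a) q)(A) = q(A) (A - a)\<close>, the roots of a polynomial can be
  peeled off one at a time, each acting on the vector.\<close>

lemma poly_act_linear_factor:
  "poly_act A ([:-a, 1:] * q) v = poly_act A q (A *v v - a *s v)"
proof -
  define N where "N = degree q"
  let ?f = "\<lambda>i. (((*v) A) ^^ i) v"
  have d: "degree ([:-a, 1:] * q) \<le> Suc N"
    unfolding N_def using degree_mult_le[of "[:-a,1:]" q] by simp
  have "poly_act A ([:-a, 1:] * q) v
      = (\<Sum>i\<le>Suc N. (coeff (pCons 0 q) i - a * coeff q i) *s ?f i)"
    by (subst poly_act_altdef[OF d]) (simp add: algebra_simps)
  also have "\<dots> = (\<Sum>i\<le>Suc N. coeff (pCons 0 q) i *s ?f i) - (\<Sum>i\<le>Suc N. (a * coeff q i) *s ?f i)"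
    by (simp only: vec.scale_left_diff_distrib sum_subtractf)
  also have "(\<Sum>i\<le>Suc N. coeff (pCons 0 q) i *s ?f i) = (\<Sum>i\<le>N. coeff q i *s (((*v) A) ^^ i) (A *v v))"
    by (subst sum.atMost_Suc_shift) (simp add: funpow_swap1)
  also have "(\<Sum>i\<le>Suc N. (a * coeff q i) *s ?f i) = (\<Sum>i\<le>N. (a * coeff q i) *s ?f i)"
    by (simp add: N_def coeff_eq_0)
  finally show ?thesis
    by (simp add: poly_act_def N_def[symmetric] funpow_matrix_vector_diff_scale sum_subtractf[symmetric]
        vec.scale_right_diff_distrib vector_smult_assoc mult.commute)
qed

text \<open>Split \<open>p\<close> into linear factors and apply them successively to
  \<open>v\<close>. The vector starts outside \<open>W\<close> and ends inside, so some factor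
  \<open>A - a\<close> moves it from outside into \<open>W\<close>; the vector just before that
  factor is \<open>u\<close>.\<close>

lemma eigenvector_modulo_of_poly_act:
  fixes A :: "complex^'n^'n"
  assumes "vec.subspace W" "p \<noteq> 0" "v \<notin> W" "poly_act A p v \<in> W"
  shows "\<exists>u a. u \<notin> W \<and> A *v u - a *s u \<in> W"
  using assms(2-)
proof (induction "degree p" arbitrary: p v)
  case 0
  then obtain c where c: "p = [:c:]" "c \<noteq> 0"
    by (metis degree_0_id pCons_0_0)
  then have "c *s v \<in> W" using 0 by (simp add: poly_act_def)
  then have "inverse c *s (c *s v) \<in> W" by (rule vec.subspace_scale[OF assms(1)])
  then show ?case using c 0 by (simp add: vector_smult_assoc)
next
  case (Suc n)
  then have "\<not> constant (poly p)" by (simp add: constant_degree)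
  then obtain a where "poly p a = 0" using fundamental_theorem_of_algebra by blast
  then obtain q where q: "p = [:-a, 1:] * q" by (metis poly_eq_0_iff_dvd dvdE)
  with Suc have "q \<noteq> 0" by auto
  then have "degree p = Suc (degree q)" unfolding q by (subst degree_mult_eq) auto
  with Suc.hyps have dq: "n = degree q" by simp
  show ?case
  proof (cases "A *v v - a *s v \<in> W")
    case True
    with Suc show ?thesis by blast
  next
    case False
    show ?thesis
      using Suc.hyps(1)[OF dq \<open>q \<noteq> 0\<close> False] Suc.prems unfolding q poly_act_linear_factor by blast
  qed
qed

text \<open>With \<open>n\<close> the dimension, the \<open>n + 1\<close> vectors
  \<open>v, A v, ..., A^n v\<close> satisfy a nontrivial linear relation, whose coefficients are
  those of \<open>p\<close>.\<close>

lemma exists_annihilating_poly: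
  fixes A :: "complex^'n^'n"
  shows "\<exists>p. p \<noteq> 0 \<and> poly_act A p v = 0"
proof -
  define N where "N = CARD('n)"
  define f where "f = (\<lambda>i. (((*v) A) ^^ i) v)"
  obtain c where c: "\<exists>i\<le>N. c i \<noteq> 0" "(\<Sum>i\<le>N. c i *s f i) = 0"
  \<comment> \<open>Dependence is a property of the set of iterates, so it yields a relation indexed
    by exponents only if they are distinct; a repetition \<open>f i = f j\<close> is a relation by
    itself.\<close>
  proof (cases "inj_on f {..N}")
    case True
    have "vec.dependent (f ` {..N})"
    proof (rule ccontr)
      assume "\<not> vec.dependent (f ` {..N})"
      then have "card (f ` {..N}) \<le> vec.dim (UNIV :: (complex^'n) set)"
        by (intro vec.independent_card_le_dim) auto
      then show False using True vec_dim_card[where 'n='n and 'a=complex]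
        by (simp add: card_image N_def)
    qed
    then obtain u where u: "\<exists>x\<in>f ` {..N}. u x \<noteq> 0" "(\<Sum>x\<in>f ` {..N}. u x *s x) = 0"
      by (subst (asm) vec.dependent_finite) auto
    show ?thesis
      by (rule that[of "u \<circ> f"]) (use u True in \<open>auto simp: sum.reindex\<close>)
  next
    case False
    then obtain i j where ij: "i \<le> N" "j \<le> N" "i \<noteq> j" "f i = f j" by (auto simp: inj_on_def)
    let ?c = "\<lambda>k. (if k = i then 1 else 0) - (if k = j then 1 else 0) :: complex"
    have "(\<Sum>k\<le>N. ?c k *s f k) = (\<Sum>k\<le>N. (if k = i then f k else 0)) - (\<Sum>k\<le>N. (if k = j then f k else 0))"
      unfolding sum_subtractf[symmetric] by (rule sum.cong) auto
    also have "\<dots> = 0" using ij by simp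
    finally show ?thesis using ij by (intro that[of ?c]) auto
  qed
  define p where "p = (\<Sum>i\<le>N. monom (c i) i)"
  have co: "coeff p i = (if i \<le> N then c i else 0)" for i
    by (simp add: p_def coeff_sum)
  have "degree p \<le> N" by (rule degree_le) (simp add: co)
  then have "poly_act A p v = 0"
    using c(2) by (simp add: poly_act_altdef co f_def)
  moreover have "p \<noteq> 0" using c(1) co by (metis coeff_0)
  ultimately show ?thesis by blast
qed

lemma exists_eigenvector_modulo:
  fixes A :: "complex^'n^'n"
  assumes "vec.subspace W" "W \<noteq> UNIV"
  obtains u a where "u \<notin> W" "A *v u - a *s u \<in> W"
proof -
  obtain v where "v \<notin> W" using assms(2) by auto
  obtain p where "p \<noteq> 0" "poly_act A p v = 0" using exists_annihilating_poly by blast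
  then show ?thesis
    using eigenvector_modulo_of_poly_act[OF assms(1) \<open>p \<noteq> 0\<close> \<open>v \<notin> W\<close>] vec.subspace_0[OF assms(1)] that
    by metis
qed

lemma independent_of_not_in_span:
  fixes v :: "nat \<Rightarrow> complex^'n"
  assumes "\<And>j. j < k \<Longrightarrow> v j \<notin> vec.span (v ` {..<j})"
  shows "vec.independent (v ` {..<k}) \<and> card (v ` {..<k}) = k"
  using assms
proof (induction k)
  case (Suc k)
  have vk: "v k \<notin> vec.span (v ` {..<k})" by (rule Suc.prems) simp
  then have "v k \<notin> v ` {..<k}" using vec.span_base by metis
  with Suc.IH Suc.prems vk show ?case
    by (simp add: lessThan_Suc vec.independent_insertI)
qed (simp add: vec.independent_empty)

text \<open>While \<open>k\<close> is below the dimension, the span of the first \<open>k\<close>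
  vectors is proper, and an eigenvector modulo this span extends the list. The spans form an
  \<open>A\<close>-invariant flag.\<close>

lemma exists_flag:
  fixes A :: "complex^'n^'n"
  assumes "k \<le> CARD('n)"
  shows "\<exists>v :: nat \<Rightarrow> complex^'n. \<forall>j<k. v j \<notin> vec.span (v ` {..<j}) \<and>
           (\<exists>a. A *v v j - a *s v j \<in> vec.span (v ` {..<j}))"
  using assms
proof (induction k)
  case (Suc k)
  then obtain v :: "nat \<Rightarrow> complex^'n" where v: "\<And>j. j < k \<Longrightarrow> v j \<notin> vec.span (v ` {..<j})"
     "\<And>j. j < k \<Longrightarrow> \<exists>a. A *v v j - a *s v j \<in> vec.span (v ` {..<j})" by fastforce
  have "vec.dim (vec.span (v ` {..<k})) = k"
    using independent_of_not_in_span[of k v] v(1)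
      vec.dim_span_eq_card_independent by metis
  then have "vec.span (v ` {..<k}) \<noteq> UNIV"
    using Suc.prems vec_dim_card[where 'n='n and 'a=complex] by (metis Suc_n_not_le_n)
  then obtain u a where u: "u \<notin> vec.span (v ` {..<k})" "A *v u - a *s u \<in> vec.span (v ` {..<k})"
    using exists_eigenvector_modulo[OF vec.subspace_span] by metis
  define w where "w = v(k := u)"
  have im: "w ` {..<j} = v ` {..<j}" if "j \<le> k" for j
    using that by (auto simp: w_def)
  have "w j \<notin> vec.span (w ` {..<j}) \<and> (\<exists>a. A *v w j - a *s w j \<in> vec.span (w ` {..<j}))" if "j < Suc k" for j
  proof (cases "j = k")
    case True
    with u im[of k] show ?thesis by (auto simp: w_def)
  next
    case False
    with that have "j < k" by simp
    with v[of j] im[of j] show ?thesis by (auto simp: w_def)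
  qed
  then show ?case by blast
qed auto

lemma matrix_vector_mult_axis:
  fixes A :: "'a::semiring_1^'n^'m"
  shows "A *v axis k 1 = column k A"
  by (simp add: vec_eq_iff matrix_vector_mult_def column_def axis_def if_distrib cong: if_cong)

text \<open>The flag vectors become the columns of \<open>P\<close>. The index type carries no
  order, so the numbering \<open>e\<close> supplies one, and \<open>U\<close> is upper triangular
  with respect to it.\<close>

lemma exists_triangularization:
  fixes A :: "complex^'n^'n"
  obtains P U :: "complex^'n^'n" and e :: "'n \<Rightarrow> nat"
  where "invertible P" "A ** P = P ** U" "inj e" "\<And>i j. e j < e i \<Longrightarrow> U $ i $ j = 0"
proof -
  obtain v :: "nat \<Rightarrow> complex^'n" where v: "\<And>j. j < CARD('n) \<Longrightarrow> v j \<notin> vec.span (v ` {..<j})"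
     "\<And>j. j < CARD('n) \<Longrightarrow> \<exists>a. A *v v j - a *s v j \<in> vec.span (v ` {..<j})"
    using exists_flag[of "CARD('n)" A] by auto
  obtain e :: "'n \<Rightarrow> nat" where e: "bij_betw e UNIV {0..<CARD('n)}"
    using ex_bij_betw_finite_nat[of "UNIV :: 'n set"] by auto
  then have inj: "inj e" and range: "range e = {..<CARD('n)}" 
    by (auto simp: bij_betw_def)
  have lt: "e i < CARD('n)" for i using range by auto
  define P :: "complex^'n^'n" where "P = (\<chi> i j. v (e j) $ i)"
  have col: "column j P = v (e j)" for j by (simp add: P_def column_def vec_eq_iff)
  have cols: "columns P = v ` {..<CARD('n)}"
    unfolding columns_def col range[symmetric] by auto
  have "vec.independent (columns P)" "card (columns P) = CARD('n)"
    using independent_of_not_in_span[of "CARD('n)" v] v(1) by (auto simp: cols)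
  then have "vec.span (columns P) = UNIV"
    using vec.card_ge_dim_independent[of "columns P" UNIV]
      vec_dim_card[where 'n='n and 'a=complex] by auto
  then have inv: "invertible P"
    by (simp add: invertible_right_inverse matrix_right_invertible_span_columns)
  then obtain Q where Q: "P ** Q = mat 1" "Q ** P = mat 1" by (auto simp: invertible_def)
  define U where "U = Q ** (A ** P)"
  have "A ** P = P ** U" by (simp add: U_def matrix_mul_assoc Q)
  moreover have "U $ i $ j = 0" if ij: "e j < e i" for i j
  proof -
    \<comment> \<open>\<open>K\<close> is the kernel of the \<open>i\<close>-th coordinate in the
      basis of columns of \<open>P\<close>. It contains the flag vectors numbered below
      \<open>e i\<close>, hence also \<open>A *v v (e j)\<close>, whose \<open>i\<close>-th
      coordinate is \<open>U $ i $ j\<close>.\<close>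
    define K where "K = {x. (Q *v x) $ i = 0}"
    have K: "vec.subspace K"
      by (auto simp: vec.subspace_def K_def matrix_vector_right_distrib vector_scalar_commute)
    have vK: "v m \<in> K" if m: "m < e i" for m
    proof -
      have "m \<in> range e" using m lt[of i] range by auto
      then obtain k where k: "m = e k" by auto
      have "Q *v v m = Q *v (P *v axis k 1)"
        by (simp add: k col[symmetric] matrix_vector_mult_axis)
      also have "\<dots> = axis k 1" by (simp add: matrix_vector_mul_assoc Q)
      finally show ?thesis using m k by (auto simp: K_def axis_def)
    qed
    obtain a where a: "A *v v (e j) - a *s v (e j) \<in> vec.span (v ` {..<e j})" using v(2)[OF lt] by blast
    have "vec.span (v ` {..<e j}) \<subseteq> K"
      by (rule vec.span_minimal[OF _ K]) (use vK ij in auto)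
    with a have "A *v v (e j) - a *s v (e j) + a *s v (e j) \<in> K"
      by (intro vec.subspace_add[OF K] vec.subspace_scale[OF K]) (use vK ij in auto)
    then have "(Q *v (A *v v (e j))) $ i = 0" by (simp add: K_def)
    also have "Q *v (A *v v (e j)) = U *v axis j 1"
      by (simp add: U_def col[symmetric] matrix_vector_mult_axis[symmetric] matrix_vector_mul_assoc matrix_mul_assoc)
    finally show ?thesis by (simp add: matrix_vector_mult_axis column_def)
  qed
  ultimately show ?thesis using that inv inj by blast
qed

text \<open>A permutation \<open>p\<close> with \<open>e i \<le> e (p i)\<close> everywhere is the
  identity, because \<open>e\<close> and its rearrangement have equal sums. Every other permutation
  therefore meets a zero entry in the Leibniz formula.\<close>

lemma det_triangular:
  fixes U :: "'a::comm_ring_1^'n^'n" and e :: "'n \<Rightarrow> nat"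
  assumes "inj e" and "\<And>i j. e j < e i \<Longrightarrow> U $ i $ j = 0"
  shows "det U = (\<Prod>i\<in>UNIV. U $ i $ i)"
proof -
  have "of_int (sign p) * (\<Prod>i\<in>UNIV. U $ i $ p i) = 0"
    if "p \<in> {p. p permutes UNIV} - {id}" for p
  proof -
    from that have p: "p permutes UNIV" "p \<noteq> id" by auto
    have "\<exists>i. e (p i) < e i"
    proof (rule ccontr)
      assume "\<not> ?thesis"
      then have le: "e i \<le> e (p i)" for i by (simp add: not_less)
      have "(\<Sum>i\<in>UNIV. e i) = (\<Sum>i\<in>UNIV. e (p i))"
        using sum.permute[OF p(1), of e] by (simp add: o_def)
      then have "e i = e (p i)" for i
        using sum_mono_inv[of e UNIV "\<lambda>i. e (p i)" i] le by auto
      then have "p = id" using \<open>inj e\<close> by (auto simp: inj_def fun_eq_iff)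
      with p show False by simp
    qed
    then obtain i where "U $ i $ p i = 0" using assms(2) by blast
    then have "(\<Prod>i\<in>UNIV. U $ i $ p i) = 0" by (intro prod_zero) auto
    then show ?thesis by simp
  qed
  then have "det U = (\<Sum>p\<in>{id}. of_int (sign p) * (\<Prod>i\<in>UNIV. U $ i $ p i))"
    unfolding det_def by (intro sum.mono_neutral_right) (auto simp: permutes_id)
  then show ?thesis by simp
qed

section \<open>Matrix identities and the determinant of \<open>mat z - A\<close> under
  similarity\<close>

lemma matrix_diff_ldistrib:
  fixes A :: "'a::ring_1^'m^'n"
  shows "A ** (B - C) = A ** B - A ** C"
  by (simp add: vec_eq_iff matrix_matrix_mult_def right_diff_distrib sum_subtractf)

lemma matrix_diff_rdistrib:
  fixes A :: "'a::ring_1^'m^'n"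
  shows "(A - B) ** C = A ** C - B ** C"
  by (simp add: vec_eq_iff matrix_matrix_mult_def left_diff_distrib sum_subtractf)

lemma matrix_mult_add_rdistrib:
  fixes A :: "'a::ring_1^'m^'n"
  shows "(A + B) ** C = A ** C + B ** C"
  by (simp add: vec_eq_iff matrix_matrix_mult_def distrib_right sum.distrib)

lemma matrix_mult_minus_left: "(- A) ** B = - (A ** B)" for A :: "'a::ring_1^'m^'n"
  by (simp add: vec_eq_iff matrix_matrix_mult_def sum_negf)

lemma matrix_mult_minus_right: "A ** (- B) = - (A ** B)" for A :: "'a::ring_1^'m^'n"
  by (simp add: vec_eq_iff matrix_matrix_mult_def sum_negf)

lemma mat_matrix_mult_commute: "mat z ** A = A ** mat z" for A :: "'a::comm_ring_1^'n^'n"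
  by (simp add: vec_eq_iff matrix_matrix_mult_def mat_def if_distrib if_distribR mult.commute cong: if_cong)

lemma mat_vector_mult: "mat z *v x = z *s x" for x :: "'a::comm_ring_1^'n"
  by (simp add: vec_eq_iff matrix_vector_mult_def mat_def if_distrib if_distribR cong: if_cong)

lemma det_mat_diff_similar:
  fixes A B P :: "complex^'n^'n"
  assumes "invertible P" "A ** P = P ** B"
  shows "det (mat z - A) = det (mat z - B)"
proof -
  have "(mat z - A) ** P = P ** (mat z - B)"
    using assms(2) by (simp add: matrix_diff_ldistrib matrix_diff_rdistrib mat_matrix_mult_commute)
  then have "det (mat z - A) * det P = det P * det (mat z - B)"
    by (metis det_mul)
  then show ?thesis using assms(1) by (simp add: invertible_det_nz)
qed

lemma det_mat_diff_triangularized: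
  fixes A U P :: "complex^'n^'n" and e :: "'n \<Rightarrow> nat"
  assumes "invertible P" "A ** P = P ** U" "inj e" "\<And>i j. e j < e i \<Longrightarrow> U $ i $ j = 0"
  shows "det (mat z - A) = (\<Prod>i\<in>UNIV. z - U $ i $ i)"
proof -
  have "det (mat z - U) = (\<Prod>i\<in>UNIV. (mat z - U) $ i $ i)"
    by (rule det_triangular[OF assms(3)]) (use assms(4) in \<open>auto simp: mat_def\<close>)
  then show ?thesis
    using det_mat_diff_similar[OF assms(1,2)] by (simp add: mat_def)
qed

section \<open>The characteristic polynomial\<close>

text \<open>Evaluation at \<open>z\<close> is a ring homomorphism and so commutes with the Leibniz
  formula. Characteristic polynomials can thus be studied through the values of
  \<open>det (mat z - A)\<close>.\<close>

lemma poly_charpoly: "poly (charpoly A) z = det (mat z - A)"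
proof -
  have "poly (of_int (sign p)) z = of_int (sign p)" for p :: "'a \<Rightarrow> 'a"
    by (simp add: sign_def)
  then show ?thesis
    by (auto simp: charpoly_def det_def poly_sum poly_prod mat_def intro!: sum.cong prod.cong)
qed

lemma charpoly_eq_prod:
  fixes A :: "complex^'n^'n" and d :: "'n \<Rightarrow> complex"
  assumes "\<And>z. det (mat z - A) = (\<Prod>i\<in>UNIV. z - d i)"
  shows "charpoly A = (\<Prod>i\<in>UNIV. [:- d i, 1:])"
  by (subst poly_eq_poly_eq_iff[symmetric]) (simp add: fun_eq_iff poly_charpoly assms poly_prod)

text \<open>The order at \<open>a\<close> is additive on nonzero products, and a linear factor
  contributes 1 at its own root and 0 elsewhere.\<close>

lemma order_prod_linear:
  fixes d :: "'a \<Rightarrow> complex"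
  assumes "finite I"
  shows "order a (\<Prod>i\<in>I. [:- d i, 1:]) = card {i\<in>I. d i = a}"
  using assms
proof (induction I)
  case (insert j I)
  have nz: "(\<Prod>i\<in>I. [:- d i, 1:]) \<noteq> 0" using insert by auto
  have 1: "order a [:- d j, 1:] = (if d j = a then 1 else 0)"
    using order_power_n_n[of a 1] by (auto intro: order_0I)
  have 2: "{i \<in> insert j I. d i = a} = (if d j = a then insert j {i\<in>I. d i = a} else {i\<in>I. d i = a})"
    by auto
  have "order a (\<Prod>i\<in>insert j I. [:- d i, 1:]) = order a ([:- d j, 1:] * (\<Prod>i\<in>I. [:- d i, 1:]))"
    using insert by simp
  also have "\<dots> = order a [:- d j, 1:] + order a (\<Prod>i\<in>I. [:- d i, 1:])"
    using nz by (intro order_mult) (simp del: mult_pCons_left)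
  finally show ?case using insert unfolding 1 2 by simp
qed simp

lemma alg_mult_eq_card:
  fixes A :: "complex^'n^'n" and d :: "'n \<Rightarrow> complex"
  assumes "\<And>z. det (mat z - A) = (\<Prod>i\<in>UNIV. z - d i)"
  shows "alg_mult A a = card {i. d i = a}"
  using order_prod_linear[of UNIV a d] by (simp add: alg_mult_def charpoly_eq_prod[OF assms])

text \<open>Triangularizing \<open>A\<close> by \<open>P\<close> also triangularizes
  \<open>-A\<close>, with diagonal negated. The hypothesis then factors
  \<open>det (mat z - A)\<close> in two ways, with roots \<open>U $ i $ i\<close> and with roots
  \<open>- U $ i $ i\<close>; counting roots in both gives the multiplicities at \<open>-a\<close>
  and \<open>a\<close>.\<close>

lemma balanced_if_det_eq:
  fixes A :: "complex^'n^'n"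
  assumes "\<And>z. det (mat z - A) = det (mat z + A)"
  shows "balanced A"
proof -
  obtain P U :: "complex^'n^'n" and e :: "'n \<Rightarrow> nat"
    where PU: "invertible P" "A ** P = P ** U" "inj e" "\<And>i j. e j < e i \<Longrightarrow> U $ i $ j = 0"
    using exists_triangularization[of A] by blast
  have A: "det (mat z - A) = (\<Prod>i\<in>UNIV. z - U $ i $ i)" for z
    by (rule det_mat_diff_triangularized[OF PU])
  have "det (mat z - (- A)) = (\<Prod>i\<in>UNIV. z - (- U) $ i $ i)" for z
    by (rule det_mat_diff_triangularized[OF PU(1) _ PU(3)])
       (use PU in \<open>auto simp: matrix_mult_minus_left matrix_mult_minus_right\<close>)
  then have "det (mat z - A) = (\<Prod>i\<in>UNIV. z - - U $ i $ i)" for z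
    by (simp add: assms)
  then have "alg_mult A a = card {i. - U $ i $ i = a}" for a
    by (rule alg_mult_eq_card)
  moreover have "alg_mult A (- a) = card {i. U $ i $ i = - a}" for a
    by (rule alg_mult_eq_card[OF A])
  moreover have "{i. - U $ i $ i = a} = {i. U $ i $ i = - a}" for a by auto
  ultimately show ?thesis by (simp add: balanced_def)
qed

section \<open>Limits of matrices and exchanging the factors of a product\<close>

lemma eventually_not_in_finite:
  fixes a :: "'a::t1_space"
  assumes "finite F"
  shows "eventually (\<lambda>t. t \<notin> F) (at a)"
  unfolding eventually_at_topological
  \<comment> \<open>The filter \<open>at a\<close> ignores the point \<open>a\<close>, so
    \<open>a\<close> itself may belong to \<open>F\<close>.\<close>
  by (rule exI[of _ "- (F - {a})"]) (use assms in \<open>auto simp del: Compl_Diff_eq intro!: open_Compl finite_imp_closed\<close>)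

lemma tendsto_det:
  fixes f :: "'b \<Rightarrow> complex^'n^'n"
  assumes "(f \<longlongrightarrow> A) F"
  shows "((\<lambda>t. det (f t)) \<longlongrightarrow> det A) F"
  unfolding det_def by (intro tendsto_intros assms)

lemma tendsto_matrix_mult:
  fixes f g :: "'b \<Rightarrow> complex^'n^'n"
  assumes "(f \<longlongrightarrow> A) F" "(g \<longlongrightarrow> B) F"
  shows "((\<lambda>t. f t ** g t) \<longlongrightarrow> A ** B) F"
  unfolding matrix_matrix_mult_def by (intro tendsto_intros assms)

definition diag :: "('n \<Rightarrow> complex) \<Rightarrow> complex^'n^'n" where
  "diag d = (\<chi> i j. if i = j then d i else 0)"

lemma tendsto_diag:
  assumes "\<And>i. ((\<lambda>t. f t i) \<longlongrightarrow> d i) F"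
  shows "((\<lambda>t. diag (f t)) \<longlongrightarrow> diag d) F"
proof -
  have "((\<lambda>t. if i = j then f t i else 0) \<longlongrightarrow> (if i = j then d i else 0)) F" for i j
    using assms by auto
  then show ?thesis unfolding diag_def by (intro tendsto_vec_lambda)
qed

text \<open>For invertible \<open>A\<close> the two products are similar; in general \<open>A\<close> is a limit
  of the invertible matrices \<open>A + t I\<close>.\<close>

lemma det_mat_diff_mult_commute:
  fixes A B :: "complex^'n^'n"
  shows "det (mat z - A ** B) = det (mat z - B ** A)"
proof -
  \<comment> \<open>Triangularizing \<open>-A\<close> turns
    \<open>det (A + mat t) = det (mat t - (-A))\<close> into a product that vanishes for only
    finitely many \<open>t\<close>.\<close>
  obtain P U :: "complex^'n^'n" and e :: "'n \<Rightarrow> nat"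
    where PU: "invertible P" "(-A) ** P = P ** U" "inj e" "\<And>i j. e j < e i \<Longrightarrow> U $ i $ j = 0"
    using exists_triangularization[of "-A"] by blast
  have d: "det (A + mat t) = (\<Prod>i\<in>UNIV. t - U $ i $ i)" for t
    using det_mat_diff_triangularized[OF PU, of t] by (simp add: add.commute)
  have "eventually (\<lambda>t. t \<notin> range (\<lambda>i. U $ i $ i)) (at 0)"
    by (rule eventually_not_in_finite) simp
  then have ev: "eventually (\<lambda>t. det (mat z - (A + mat t) ** B) = det (mat z - B ** (A + mat t))) (at 0)"
  proof eventually_elim
    case (elim t)
    then have "det (A + mat t) \<noteq> 0" unfolding d by auto
    then have inv: "invertible (A + mat t)" by (simp add: invertible_det_nz)
    \<comment> \<open>With \<open>C = A + mat t\<close>, the matrix \<open>C\<close> intertwines the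
      two products: \<open>(C B) C = C (B C)\<close>.\<close>
    show ?case
      by (rule det_mat_diff_similar[OF inv]) (simp add: matrix_mul_assoc)
  qed
  have mt: "((\<lambda>t. mat t :: complex^'n^'n) \<longlongrightarrow> 0) (at 0)"
    using tendsto_diag[of "\<lambda>t i. t" "\<lambda>_. 0" "at 0"] by (simp add: diag_def mat_def zero_vec_def)
  have At: "((\<lambda>t. A + mat t) \<longlongrightarrow> A) (at 0)" using tendsto_add[OF tendsto_const[of A] mt] by simp
  have "((\<lambda>t. det (mat z - (A + mat t) ** B)) \<longlongrightarrow> det (mat z - A ** B)) (at 0)"
    by (intro tendsto_det tendsto_diff tendsto_const tendsto_matrix_mult At)
  then have "((\<lambda>t. det (mat z - B ** (A + mat t))) \<longlongrightarrow> det (mat z - A ** B)) (at 0)"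
    using tendsto_cong[OF ev] by blast
  moreover have "((\<lambda>t. det (mat z - B ** (A + mat t))) \<longlongrightarrow> det (mat z - B ** A)) (at 0)"
    by (intro tendsto_det tendsto_diff tendsto_const tendsto_matrix_mult At)
  ultimately show ?thesis by (rule tendsto_unique[rotated]) simp
qed

section \<open>Commutators of square-zero matrices\<close>

definition nil2_commutators :: "(complex^'n^'n) set" where
  "nil2_commutators = {M ** N - N ** M | M N. M ** M = 0 \<and> N ** N = 0}"

lemma det_eq_if_nil2_commutator:
  assumes "T \<in> nil2_commutators"
  shows "det (mat z - T) = det (mat z + T)"
proof -
  from assms obtain M N where MN: "T = M ** N - N ** M" "M ** M = 0" "N ** N = 0"
    by (auto simp: nil2_commutators_def)
  have "(M - N) ** (M + N) = T" "(M + N) ** (M - N) = - T"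
    by (simp_all add: MN matrix_diff_ldistrib matrix_diff_rdistrib matrix_add_ldistrib matrix_mult_add_rdistrib)
  then show ?thesis
    using det_mat_diff_mult_commute[of z "M - N" "M + N"] by simp
qed

text \<open>For each \<open>z\<close> both sides are continuous in the entries of \<open>T\<close>,
  and an intersection of closed sets is closed. Expressing balance by determinants instead of
  multiplicities is what makes closedness visible.\<close>

lemma closed_det_eq: "closed {T :: complex^'n^'n. \<forall>z. det (mat z - T) = det (mat z + T)}"
proof -
  have "closed {T :: complex^'n^'n. det (mat z - T) = det (mat z + T)}" for z
    unfolding det_def by (intro closed_Collect_eq continuous_intros)
  then have "closed (\<Inter>z. {T :: complex^'n^'n. det (mat z - T) = det (mat z + T)})" by blast
  then show ?thesis by (simp add: Collect_all_eq)
qed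

text \<open>Conjugating \<open>M\<close> and \<open>N\<close> by \<open>P\<close> respects products,
  hence both the square-zero conditions and the commutator.\<close>

lemma nil2_commutators_similar:
  fixes A B P :: "complex^'n^'n"
  assumes "B \<in> nil2_commutators" "invertible P" "A ** P = P ** B"
  shows "A \<in> nil2_commutators"
proof -
  from assms obtain M N where MN: "B = M ** N - N ** M" "M ** M = 0" "N ** N = 0"
    by (auto simp: nil2_commutators_def)
  obtain Q where Q: "P ** Q = mat 1" "Q ** P = mat 1" using assms(2) by (auto simp: invertible_def)
  have conj: "(P ** X ** Q) ** (P ** Y ** Q) = P ** (X ** Y) ** Q" for X Y
  proof -
    have "(P ** X ** Q) ** (P ** Y ** Q) = P ** X ** (Q ** P) ** Y ** Q"
      by (simp only: matrix_mul_assoc)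
    then show ?thesis by (simp add: Q matrix_mul_assoc)
  qed
  have "A = A ** P ** Q" by (simp add: matrix_mul_assoc[symmetric] Q)
  also have "\<dots> = P ** B ** Q" by (simp add: assms)
  also have "\<dots> = (P ** M ** Q) ** (P ** N ** Q) - (P ** N ** Q) ** (P ** M ** Q)"
    unfolding conj by (simp add: MN matrix_diff_ldistrib matrix_diff_rdistrib)
  finally show ?thesis
    unfolding nil2_commutators_def using conj[of M M] conj[of N N] MN by auto
qed

text \<open>From each two-element orbit of the involution \<open>s\<close>, the set \<open>R\<close>
  takes the element with the smaller number; fixed points stay outside.\<close>

lemma exists_representatives:
  fixes s :: "'a::finite \<Rightarrow> 'a"
  assumes "\<And>i. s (s i) = i"
  obtains R where "\<And>i. i \<in> R \<Longrightarrow> s i \<notin> R" "\<And>i. i \<notin> R \<Longrightarrow> s i \<notin> R \<Longrightarrow> s i = i"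
proof -
  obtain e :: "'a \<Rightarrow> nat" where "bij_betw e UNIV {0..<CARD('a)}"
    using ex_bij_betw_finite_nat[of "UNIV :: 'a set"] by auto
  then have "inj e" by (auto simp: bij_betw_def)
  show ?thesis
  proof (rule that[of "{i. e i < e (s i)}"])
    fix i assume "i \<notin> {i. e i < e (s i)}" "s i \<notin> {i. e i < e (s i)}"
    then have "e (s i) = e i" using assms by auto
    then show "s i = i" using \<open>inj e\<close> by (simp add: inj_def)
  qed (use assms in auto)
qed

text \<open>For \<open>i\<close> in \<open>R\<close>, the block on the orbit of \<open>i\<close> is
  \<open>d i\<close> times the matrix unit at \<open>(i, s i)\<close> for \<open>M\<close>, and the
  unit at \<open>(s i, i)\<close> for \<open>N\<close>; their commutator has diagonal entries
  \<open>d i\<close> and \<open>- d i\<close>.\<close>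

lemma diag_nil2_commutator:
  fixes d :: "'n::finite \<Rightarrow> complex" and s :: "'n::finite \<Rightarrow> 'n"
  assumes s: "\<And>i. s (s i) = i" and d: "\<And>i. d (s i) = - d i"
  shows "diag d \<in> nil2_commutators"
proof -
  obtain R where R: "\<And>i. i \<in> R \<Longrightarrow> s i \<notin> R" "\<And>i. i \<notin> R \<Longrightarrow> s i \<notin> R \<Longrightarrow> s i = i"
    using exists_representatives[of s] s by blast
  define M :: "complex^'n^'n" where "M = (\<chi> i j. if j = s i then (if i \<in> R then d i else 0) else 0)"
  define N :: "complex^'n^'n" where "N = (\<chi> i j. if j = s i then (if s i \<in> R then 1 else 0) else 0)"
  \<comment> \<open>Matrices supported on the positions \<open>(i, s i)\<close> have diagonal
    products, as \<open>s\<close> is an involution.\<close>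
  have prod: "(\<Sum>j\<in>UNIV. (if j = s i then a else 0) * (if k = s j then b j else 0))
       = (if k = i then a * b (s i) else 0)" for i k a and b :: "'n \<Rightarrow> complex"
  proof -
    have "(\<Sum>j\<in>UNIV. (if j = s i then a else 0) * (if k = s j then b j else 0))
       = (\<Sum>j\<in>UNIV. if j = s i then (if k = i then a * b (s i) else 0) else 0)"
      by (rule sum.cong) (auto simp: s)
    then show ?thesis by simp
  qed
  \<comment> \<open>At a fixed point the commutator has diagonal entry 0, and
    \<open>d i = - d i\<close> forces the same value for \<open>d\<close>.\<close>
  have d0: "d i = 0" if "s i = i" for i using d[of i] that by simp
  have "M ** M = 0" "N ** N = 0"
    using R(1) s by (auto simp: vec_eq_iff M_def N_def matrix_matrix_mult_def prod)
  moreover have "M ** N - N ** M = diag d"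
    using R s d d0 by (auto simp: vec_eq_iff M_def N_def matrix_matrix_mult_def prod diag_def)
  ultimately show ?thesis unfolding nil2_commutators_def by (smt (verit) mem_Collect_eq)
qed

section \<open>Perturbing a balanced matrix\<close>

text \<open>Remove pairs of distinct indices with opposite values as long as there are any; the
  counting condition survives. The clause on fixed points is what later permits a perturbation that
  is both odd and injective.\<close>

lemma exists_pairing:
  fixes d :: "'a \<Rightarrow> complex"
  assumes "finite I" "\<And>a. card {i\<in>I. d i = a} = card {i\<in>I. d i = -a}"
  shows "\<exists>s. (\<forall>i\<in>I. s i \<in> I \<and> s (s i) = i \<and> d (s i) = - d i) \<and>
             (\<forall>i\<in>I. \<forall>j\<in>I. s i = i \<longrightarrow> s j = j \<longrightarrow> i = j)"
  using assms
proof (induction "card I" arbitrary: I rule: less_induct)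
  case less
  have opp: "\<exists>j\<in>I. d j = - d i" if "i \<in> I" for i
  proof -
    have "card {j\<in>I. d j = d i} \<noteq> 0" using that less.prems(1) by auto
    then have "card {j\<in>I. d j = - d i} \<noteq> 0" using less.prems(2) by metis
    then show ?thesis by (metis (mono_tags, lifting) card.empty empty_Collect_eq)
  qed
  show ?case
  proof (cases "\<exists>i\<in>I. \<exists>j\<in>I. i \<noteq> j \<and> d j = - d i")
    case False
    \<comment> \<open>The only index with value \<open>- d i\<close> is \<open>i\<close> itself. Two
      indices with value 0 would form a removable pair, so \<open>I\<close> has at most one element
      and the identity serves as \<open>s\<close>.\<close>
    then have "d i = 0" if "i \<in> I" for i using opp[OF that] that by fastforce
    with False show ?thesis by (intro exI[of _ id]) fastforce
  next
    case True
    then obtain i j where ij: "i \<in> I" "j \<in> I" "i \<noteq> j" "d j = - d i" by blast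
    define J where "J = I - {i, j}"
    have lt: "card J < card I" unfolding J_def using ij less.prems(1) by (intro psubset_card_mono) auto
    have cJ: "card {k\<in>J. d k = a} = card {k\<in>J. d k = - a}" for a
    proof -
      \<comment> \<open>Since \<open>d j = - d i\<close>, the indices \<open>i\<close> and
        \<open>j\<close> together contribute equally to the counts at \<open>a\<close> and at
        \<open>-a\<close>, so these contributions cancel.\<close>
      have "card {k\<in>I. d k = b} = card {k\<in>J. d k = b} + (if d i = b then 1 else 0) + (if d j = b then 1 else 0)" for b
      proof -
        have "card {k\<in>I. d k = b} = (\<Sum>k\<in>I. if d k = b then 1 else 0)"
          using less.prems(1) by (simp add: sum.If_cases Int_def)
        also have "\<dots> = (\<Sum>k\<in>J. if d k = b then 1 else 0) + (\<Sum>k\<in>{i,j}. if d k = b then 1 else 0)"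
          unfolding J_def using ij less.prems(1) by (intro sum.subset_diff) auto
        also have "(\<Sum>k\<in>J. if d k = b then 1 else 0) = card {k\<in>J. d k = b}"
          using less.prems(1) by (simp add: J_def sum.If_cases Int_def)
        finally show ?thesis using ij by simp
      qed
      from this[of a] this[of "-a"] less.prems(2)[of a] ij(4) show ?thesis
        by (cases "d i = a"; cases "d i = -a") auto
    qed
    have fJ: "finite J" using less.prems(1) by (simp add: J_def)
    obtain s where "(\<forall>i\<in>J. s i \<in> J \<and> s (s i) = i \<and> d (s i) = - d i) \<and>
        (\<forall>i\<in>J. \<forall>j\<in>J. s i = i \<longrightarrow> s j = j \<longrightarrow> i = j)"
      using less.hyps[OF lt fJ cJ] by (rule exE)
    then have s: "\<forall>i\<in>J. s i \<in> J \<and> s (s i) = i \<and> d (s i) = - d i"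
      "\<forall>i\<in>J. \<forall>j\<in>J. s i = i \<longrightarrow> s j = j \<longrightarrow> i = j" by simp_all
    define t where "t = s(i := j, j := i)"
    have tJ: "t k = s k" if "k \<in> J" for k using that by (auto simp: t_def J_def)
    have I: "I = insert i (insert j J)" using ij by (auto simp: J_def)
    have tij: "t i = j" "t j = i" using ij by (auto simp: t_def)
    have "t k \<in> I \<and> t (t k) = k \<and> d (t k) = - d k" if "k \<in> I" for k
    proof -
      consider "k = i" | "k = j" | "k \<in> J" using \<open>k \<in> I\<close> I by blast
      then show ?thesis
      proof cases
        case 3
        with s(1) have "s k \<in> J" "s (s k) = k" "d (s k) = - d k" by simp_all
        with 3 show ?thesis by (simp add: tJ I)
      qed (simp_all add: tij ij)
    qed
    moreover have "k = l" if "k \<in> I" "l \<in> I" "t k = k" "t l = l" for k l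
    proof -
      have "k \<in> J" "l \<in> J" using that tij \<open>i \<noteq> j\<close> by (auto simp: J_def)
      with s(2) that tJ show ?thesis by metis
    qed
    ultimately show ?thesis by (intro exI[of _ t]) blast
  qed
qed

text \<open>This supplies the direction of perturbation: distinct positive integers on
  \<open>R\<close>, their negatives on the partners, and 0 at the possible fixed point.\<close>

lemma exists_odd_injection:
  fixes s :: "'n::finite \<Rightarrow> 'n"
  assumes s: "\<And>i. s (s i) = i" and fixed: "\<And>i j. s i = i \<Longrightarrow> s j = j \<Longrightarrow> i = j"
  obtains c :: "'n \<Rightarrow> complex" where "inj c" "\<And>i. c (s i) = - c i"
proof -
  obtain R where R: "\<And>i. i \<in> R \<Longrightarrow> s i \<notin> R" "\<And>i. i \<notin> R \<Longrightarrow> s i \<notin> R \<Longrightarrow> s i = i"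
    using exists_representatives[of s] s by blast
  obtain e :: "'n \<Rightarrow> nat" where "bij_betw e UNIV {0..<CARD('n)}"
    using ex_bij_betw_finite_nat[of "UNIV :: 'n set"] by auto
  then have e: "inj e" by (auto simp: bij_betw_def)
  \<comment> \<open>The numbering \<open>e\<close> may take the value 0, so the shift by 1 keeps 0
    free for the fixed point and separates the two signs.\<close>
  define c :: "'n \<Rightarrow> int" where
    "c i = (if i \<in> R then int (e i) + 1 else if s i \<in> R then - int (e (s i)) - 1 else 0)" for i
  have "c (s i) = - c i" for i using R(1) s by (auto simp: c_def)
  moreover have "inj c"
  proof (rule injI)
    fix i j assume "c i = c j"
    then have "i \<in> R \<and> j \<in> R \<and> e i = e j \<or> s i \<in> R \<and> s j \<in> R \<and> e (s i) = e (s j) \<or> s i = i \<and> s j = j"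
      using R(2) by (auto simp: c_def split: if_splits)
    then show "i = j" using e fixed s by (metis injD)
  qed
  ultimately show ?thesis
    by (intro that[of "of_int \<circ> c"]) (auto simp: inj_def)
qed

section \<open>Diagonalization of matrices with distinct eigenvalues\<close>

lemma diagonalizable_if_distinct:
  fixes A :: "complex^'n^'n" and d :: "'n \<Rightarrow> complex"
  assumes "\<And>z. det (mat z - A) = (\<Prod>i\<in>UNIV. z - d i)" and "inj d"
  obtains Q where "invertible Q" "A ** Q = Q ** diag d"
proof -
  have "\<exists>v. v \<noteq> 0 \<and> A *v v = d i *s v" for i
  proof -
    have "det (mat (d i) - A) = 0" unfolding assms(1) by (intro prod_zero) auto
    then have "\<not> invertible (mat (d i) - A)" by (simp add: invertible_det_nz)
    then obtain v where "v \<noteq> 0" "(mat (d i) - A) *v v = 0"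
      by (auto simp: invertible_left_inverse matrix_left_invertible_ker)
    then show ?thesis by (auto simp: matrix_vector_mult_diff_rdistrib mat_vector_mult)
  qed
  then obtain v where v: "\<And>i. v i \<noteq> 0" "\<And>i. A *v v i = d i *s v i" by metis
  define Q :: "complex^'n^'n" where "Q = (\<chi> i j. v j $ i)"
  have AQ: "A ** Q = Q ** diag d"
  proof -
    have "(A ** Q) $ i $ j = (Q ** diag d) $ i $ j" for i j
    proof -
      have "(A ** Q) $ i $ j = (A *v v j) $ i"
        by (simp add: matrix_matrix_mult_def matrix_vector_mult_def Q_def)
      also have "\<dots> = (Q ** diag d) $ i $ j"
        by (simp add: v matrix_matrix_mult_def Q_def diag_def if_distrib mult.commute cong: if_cong)
      finally show ?thesis .
    qed
    then show ?thesis by (simp add: vec_eq_iff)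
  qed
  \<comment> \<open>Independence of the eigenvectors, by induction on the support of a relation
    \<open>x\<close>. Applying \<open>diag d\<close> minus \<open>d i\<close> keeps \<open>x\<close>
    in the kernel of \<open>Q\<close> but removes the coordinate \<open>i\<close>. By induction the
    result is 0, so \<open>x\<close> is supported at \<open>i\<close> alone, contradicting
    \<open>v i \<noteq> 0\<close>.\<close>
  have ker: "x = 0" if "Q *v x = 0" for x
    using that
  proof (induction "card {i. x $ i \<noteq> 0}" arbitrary: x rule: less_induct)
    case less
    show ?case
    proof (rule ccontr)
      assume "x \<noteq> 0"
      then obtain i where i: "x $ i \<noteq> 0" by (auto simp: vec_eq_iff)
      define y where "y = diag d *v x - d i *s x"
      have y: "y $ j = (d j - d i) * x $ j" for j
        by (simp add: y_def diag_def matrix_vector_mult_def if_distrib if_distribR algebra_simps cong: if_cong)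
      have "Q *v (diag d *v x) = 0"
        using less.prems by (simp add: matrix_vector_mul_assoc AQ[symmetric]) (simp add: matrix_vector_mul_assoc[symmetric])
      then have "Q *v y = 0"
        using less.prems by (simp add: y_def matrix_vector_mult_diff_distrib vector_scalar_commute)
      moreover have "card {j. y $ j \<noteq> 0} < card {j. x $ j \<noteq> 0}"
        by (intro psubset_card_mono) (use i in \<open>auto simp: y\<close>)
      ultimately have "y = 0" using less.hyps by blast
      then have xj: "x $ j = 0" if "j \<noteq> i" for j
        using y[of j] that \<open>inj d\<close> by (auto simp: inj_def)
      have "Q *v x = x $ i *s v i"
      proof -
        have "(\<Sum>j\<in>UNIV. v j $ k * x $ j) = (\<Sum>j\<in>UNIV. if j = i then v i $ k * x $ i else 0)" for k
          by (rule sum.cong) (auto simp: xj)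
        then show ?thesis by (simp add: vec_eq_iff matrix_vector_mult_def Q_def mult.commute)
      qed
      then show False using less.prems i v(1)[of i] by simp
    qed
  qed
  then have "invertible Q" by (simp add: invertible_left_inverse matrix_left_invertible_ker)
  with AQ that show ?thesis by blast
qed

lemma balanced_in_closure_nil2_commutators:
  fixes T :: "complex^'n^'n"
  assumes "balanced T"
  shows "T \<in> closure nil2_commutators"
proof -
  obtain P U :: "complex^'n^'n" and e :: "'n \<Rightarrow> nat"
    where PU: "invertible P" "T ** P = P ** U" "inj e" "\<And>i j. e j < e i \<Longrightarrow> U $ i $ j = 0"
    using exists_triangularization[of T] by blast
  define d where "d i = U $ i $ i" for i
  have "det (mat z - T) = (\<Prod>i\<in>UNIV. z - d i)" for z
    unfolding d_def by (rule det_mat_diff_triangularized[OF PU])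
  from alg_mult_eq_card[OF this] have "card {i. d i = a} = card {i. d i = - a}" for a
    using assms by (simp add: balanced_def)
  then have "\<exists>s. (\<forall>i. s (s i) = i \<and> d (s i) = - d i) \<and> (\<forall>i j. s i = i \<longrightarrow> s j = j \<longrightarrow> i = j)"
    using exists_pairing[of UNIV d] by simp
  then obtain s where s': "(\<forall>i. s (s i) = i \<and> d (s i) = - d i) \<and> (\<forall>i j. s i = i \<longrightarrow> s j = j \<longrightarrow> i = j)"
    by (rule exE)
  have s: "s (s i) = i" "d (s i) = - d i" for i using s' by simp_all
  have fixed: "i = j" if "s i = i" "s j = j" for i j using s' that by metis
  obtain c :: "'n \<Rightarrow> complex" where c: "inj c" "\<And>i. c (s i) = - c i"
    by (rule exists_odd_injection[of s, OF s(1) fixed]) (assumption | rule that)+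
  obtain Q where Q: "P ** Q = mat 1" "Q ** P = mat 1" using PU(1) by (auto simp: invertible_def)
  \<comment> \<open>In the triangularizing basis this adds \<open>t * c i\<close> to the
    \<open>i\<close>-th diagonal entry of \<open>U\<close> and leaves the rest unchanged.\<close>
  define X where "X t = T + P ** diag (\<lambda>i. t * c i) ** Q" for t
  have XP: "X t ** P = P ** (U + diag (\<lambda>i. t * c i))" for t
    by (simp add: X_def matrix_add_ldistrib matrix_mult_add_rdistrib PU(2) matrix_mul_assoc[symmetric] Q)
  \<comment> \<open>These are the parameters at which two perturbed diagonal entries can collide.
    The pairs with \<open>i = j\<close> contribute \<open>0 / 0 = 0\<close>, harmless because only
    \<open>t \<noteq> 0\<close> matters in the limit.\<close>
  define F where "F = (\<lambda>(i, j). (d j - d i) / (c i - c j)) ` UNIV"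
  have "eventually (\<lambda>t. t \<notin> F) (at 0)"
    by (rule eventually_not_in_finite) (simp add: F_def)
  then have ev: "eventually (\<lambda>t. X t \<in> closure nil2_commutators) (at 0)"
  proof eventually_elim
    case (elim t)
    define d' where "d' i = d i + t * c i" for i
    have "inj d'"
    proof (rule injI, rule ccontr)
      fix i j assume "d' i = d' j" "i \<noteq> j"
      then have "c i - c j \<noteq> 0" using c(1) by (auto simp: inj_def)
      moreover have "t * (c i - c j) = d j - d i" using \<open>d' i = d' j\<close> by (simp add: d'_def algebra_simps)
      ultimately have "t = (d j - d i) / (c i - c j)" by (simp add: field_simps)
      then have "t \<in> F" unfolding F_def by (intro image_eqI[of _ _ "(i, j)"]) auto
      with elim show False by blast
    qed
    have "det (mat z - X t) = (\<Prod>i\<in>UNIV. z - (U + diag (\<lambda>i. t * c i)) $ i $ i)" for z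
      by (rule det_mat_diff_triangularized[OF PU(1) XP PU(3)]) (auto simp: PU(4) diag_def)
    then have "det (mat z - X t) = (\<Prod>i\<in>UNIV. z - d' i)" for z
      by (simp add: d'_def d_def diag_def)
    then obtain S where S: "invertible S" "X t ** S = S ** diag d'"
      using diagonalizable_if_distinct[OF _ \<open>inj d'\<close>, of "X t"] by blast
    \<comment> \<open>Both \<open>d\<close> and \<open>c\<close> change sign under \<open>s\<close>,
      hence so does \<open>d'\<close>.\<close>
    have "diag d' \<in> nil2_commutators"
      by (rule diag_nil2_commutator[of s]) (simp_all add: s d'_def c)
    then show ?case using nil2_commutators_similar S closure_subset by blast
  qed
  have "((\<lambda>t. diag (\<lambda>i. t * c i)) \<longlongrightarrow> diag (\<lambda>i. 0 * c i)) (at 0)"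
    by (intro tendsto_diag tendsto_intros)
  moreover have "diag (\<lambda>i::'n. 0) = 0" by (simp add: diag_def vec_eq_iff)
  ultimately have "((\<lambda>t. diag (\<lambda>i. t * c i)) \<longlongrightarrow> 0) (at 0)" by simp
  then have "(X \<longlongrightarrow> T + P ** 0 ** Q) (at 0)"
    unfolding X_def by (intro tendsto_add tendsto_const tendsto_matrix_mult)
  then show ?thesis
    using Lim_in_closed_set[OF closed_closure ev] by simp
qed

theorem theorem4p03:
  shows "closure {M ** N - N ** M | M N :: complex^'n::finite^'n.
                    M ** M = 0 \<and> N ** N = 0} = {T. balanced T}"
proof -
  \<comment> \<open>The determinant identity holds for the commutators and is closed, so it passes
    to the closure, where it implies balance.\<close>
  have "closure (nil2_commutators :: (complex^'n^'n) set) \<subseteq> {T. \<forall>z. det (mat z - T) = det (mat z + T)}"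
    by (rule closure_minimal[OF _ closed_det_eq]) (use det_eq_if_nil2_commutator in blast)
  then have "closure (nil2_commutators :: (complex^'n^'n) set) = {T. balanced T}"
    using balanced_if_det_eq balanced_in_closure_nil2_commutators by blast
  then show ?thesis by (simp only: nil2_commutators_def)
qed

end
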